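(* Let $A_1,\dots,A_m\in\mathbb{R}^{n\times n}$ be the network mode matrices of a traffic network, let $C_{\mathrm{av}}\in\mathbb{R}^{n_r\times n}$ be its queue-length output matrix, let $T>0$ be the cycle time and let $x_0\in\mathbb{R}^n$ be the initial state (all as defined in the context). For $A_{\mathrm{av}}\in\mathbb{R}^{n\times n}$ let $$\mathcal{W}(A_{\mathrm{av}},x_0)=\int_0^\infty e^{A_{\mathrm{av}}t}\,x_0x_0^{\mathsf T}\,e^{A_{\mathrm{av}}^{\mathsf T}t}\,dt .$$ Then the minimization problem $$\min_{d_1,\dots,d_m}\ \operatorname{Trace}\!\left(C_{\mathrm{av}}\,\mathcal{W}(A_{\mathrm{av}},x_0)\,C_{\mathrm{av}}^{\mathsf T}\right)\quad\text{subject to}\quad A_{\mathrm{av}}=\tfrac1T(d_1A_1+\dots+d_mA_m),\quad T=d_1+\dots+d_m,\quad d_i\ge 0,\ i\in\{1,\dots,m\},$$ is equivalent to the minimization problem $$\min_{d_1,\dots,d_m}\ \int_0^\infty\|y_{\mathrm{av}}(t)\|_2^2\,dt\quad\text{subject to}\quad \dot x_{\mathrm{av}}=A_{\mathrm{av}}x_{\mathrm{av}},\quad y_{\mathrm{av}}=C_{\mathrm{av}}x_{\mathrm{av}},\quad x_{\mathrm{av}}(0)=x_0,\quad A_{\mathrm{av}}=\tfrac1T(d_1A_1+\dots+d_mA_m),\quad T=d_1+\dots+d_m,\quad d_i\ge 0,\ i\in\{1,\dots,m\}.$$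
   Context: Equivalence of the two problems means that they have the same feasible set of durations $(d_1,\dots,d_m)$ and, at every feasible point, the same cost value in $[0,+\infty]$ (divergent integrals of nonnegative functions are assigned the value $+\infty$; since $C_{\mathrm{av}}$ below selects coordinates, the trace is a sum of diagonal entries of $\mathcal W$, each an integral of a nonnegative function). Traffic network. $\mathcal N=(\mathcal R,\mathcal I)$ consists of one-way roads $\mathcal R=\{r_1,\dots,r_{n_r}\}$ and intersections $\mathcal I=\{\mathcal I_1,\dots,\mathcal I_{n_{\mathcal I}}\}$, each $\mathcal I_j\subseteq\mathcal R\times\mathcal R$ being the set of allowed movements, where $(r_i,r_k)\in\mathcal I_j$ denotes movement from $r_k$ into $r_i$. There is a set $\mathcal D\subseteq\mathcal R$ of destination roads. Road $r_i$ has length $\ell_i>0$ and is discretized into $\sigma_i=\lceil \ell_i/h\rceil$ cells, with $h>0$ a fixed discretization step; $x_i=[x_i^1\cdots x_i^{\sigma_i}]^{\mathsf T}$ is the vector of cell densities, $\gamma_i>0$ is the average speed on $r_i$, and $n=\sum_{i=1}^{n_r}\sigma_i$. Green split functions $s(r_i,r_k,t)\in\{0,1\}$ are $T$-periodic in $t$, and $s(r_i,r_k,\cdot)\equiv0$ if $(r_i,r_k)$ is not an allowed movement. $c(r_i,r_k)$ is a real outflow-rate parameter and $\bar w_{r_i}\in[0,1]$ is the exogenous outflow rate, nonzero if and only if $r_i\in\mathcal D$. Network matrix. $A=A(t)\in\mathbb{R}^{n\times n}$ has blocks $A_{ik}\in\mathbb R^{\sigma_i\times\sigma_k}$, $i,k\in\{1,\dots,n_r\}$: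 $$A_{ik}=s(r_i,r_k,t)\,c(r_i,r_k)\,e_1e_{\sigma_k}^{\mathsf T}\ (i\ne k),\qquad A_{ii}=D_i-\Big(\sum_{\ell}s(r_\ell,r_i,t)\,c(r_\ell,r_i)+\bar w_{r_i}\Big)e_{\sigma_i}e_{\sigma_i}^{\mathsf T},$$ where $e_j$ denotes the $j$-th canonical vector of the appropriate dimension, and $D_i\in\mathbb R^{\sigma_i\times\sigma_i}$ equals $\gamma_i/h$ times the matrix with diagonal $(-1,\dots,-1,0)$, all subdiagonal entries equal to $1$, and zeros elsewhere. Modes. Let $0=\tau_0<\tau_1<\dots<\tau_m=T$ be the instants in one period at which some green split function changes value. $A(t)$ is constant between consecutive instants $\tau_{i-1}$ and $\tau_i$; this constant matrix is the $i$-th network mode $A_i$, and $d_i$ denotes its duration. In the optimization problems the $A_i$ are fixed and the durations $d_i$ are the variables. Output matrix. $C_{\mathrm{av}}\in\mathbb R^{n_r\times n}$ is the block-diagonal matrix with diagonal blocks $e_{\sigma_1}^{\mathsf T},\dots,e_{\sigma_{n_r}}^{\mathsf T}$, i.e. $y_{\mathrm{av}}=C_{\mathrm{av}}x_{\mathrm{av}}$ collects the densities of the downstream (last) cells of all roads. *)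

theory Defs
  imports "HOL-Analysis.Analysis"
begin

section \<open>Traffic networks\<close>

text \<open>
  Roads are the elements of a finite type \<open>'r\<close>. A pair \<open>(i, k)\<close> in an intersection is an allowed
  movement from road \<open>k\<close> into road \<open>i\<close>; \<open>green_split\<close> and \<open>outflow_rate\<close> use the same argument order.
\<close>

record 'r traffic_network =
  intersections :: "('r \<times> 'r) set set"
  destinations :: "'r set"
  road_length :: "'r \<Rightarrow> real"
  discretization_step :: real
  road_speed :: "'r \<Rightarrow> real"
  cycle_time :: real
  green_split :: "'r \<Rightarrow> 'r \<Rightarrow> real \<Rightarrow> real"
  outflow_rate :: "'r \<Rightarrow> 'r \<Rightarrow> real"
  exogenous_outflow :: "'r \<Rightarrow> real"

definition valid_network :: "'r::finite traffic_network \<Rightarrow> bool" where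
  "valid_network N \<longleftrightarrow>
     discretization_step N > 0 \<and> cycle_time N > 0 \<and>
     (\<forall>i. road_length N i > 0) \<and> (\<forall>i. road_speed N i > 0) \<and>
     (\<forall>i k t. green_split N i k t \<in> {0, 1}) \<and>
     (\<forall>i k t. green_split N i k (t + cycle_time N) = green_split N i k t) \<and>
     (\<forall>i k. (i, k) \<notin> \<Union> (intersections N) \<longrightarrow> (\<forall>t. green_split N i k t = 0)) \<and>
     (\<forall>i. exogenous_outflow N i \<in> {0..1}) \<and>
     (\<forall>i. exogenous_outflow N i \<noteq> 0 \<longleftrightarrow> i \<in> destinations N)"

definition num_cells :: "'r traffic_network \<Rightarrow> 'r \<Rightarrow> nat" where
  "num_cells N i = nat \<lceil>road_length N i / discretization_step N\<rceil>"

text \<open>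
  The state coordinates are the elements of a finite type \<open>'n\<close>, and \<open>cell p = (i, a)\<close> says that the
  coordinate \<open>p\<close> is the density of the \<open>a\<close>-th cell of road \<open>i\<close>, with \<open>a\<close> counted from 1. No order of
  the coordinates is prescribed; stacking the vectors \<open>x\<^sub>i\<close> road after road is one instance.
\<close>

definition cell_enumeration :: "'r::finite traffic_network \<Rightarrow> ('n::finite \<Rightarrow> 'r \<times> nat) \<Rightarrow> bool" where
  "cell_enumeration N cell \<longleftrightarrow> bij_betw cell UNIV (SIGMA i:UNIV. {1..num_cells N i})"

lemma cell_enumeration_dimension:
  fixes N :: "'r::finite traffic_network" and cell :: "'n::finite \<Rightarrow> 'r \<times> nat"
  assumes "cell_enumeration N cell"
  shows "CARD('n) = (\<Sum>i\<in>UNIV. num_cells N i)"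
  using bij_betw_same_card[OF assms[unfolded cell_enumeration_def]] by simp

definition canon :: "nat \<Rightarrow> nat \<Rightarrow> real" where
  "canon j a = (if a = j then 1 else 0)"

text \<open>Entry \<open>(a, b)\<close> of the matrix \<open>D\<^sub>i\<close>.\<close>

definition transport_entry :: "'r traffic_network \<Rightarrow> 'r \<Rightarrow> nat \<Rightarrow> nat \<Rightarrow> real" where
  "transport_entry N i a b =
     road_speed N i / discretization_step N *
       (if a = b then (if a = num_cells N i then 0 else - 1)
        else if a = b + 1 then 1 else 0)"

text \<open>Entry \<open>(a, b)\<close> of the block in block row \<open>i\<close> and block column \<open>k\<close> of \<open>A(t)\<close>.\<close>

definition network_block ::
    "'r::finite traffic_network \<Rightarrow> real \<Rightarrow> 'r \<Rightarrow> 'r \<Rightarrow> nat \<Rightarrow> nat \<Rightarrow> real" where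
  "network_block N t i k a b =
     (if i \<noteq> k
      then green_split N i k t * outflow_rate N i k * (canon 1 a * canon (num_cells N k) b)
      else transport_entry N i a b
        - ((\<Sum>l\<in>UNIV. green_split N l i t * outflow_rate N l i) + exogenous_outflow N i)
          * (canon (num_cells N i) a * canon (num_cells N i) b))"

definition network_matrix ::
    "'r::finite traffic_network \<Rightarrow> ('n::finite \<Rightarrow> 'r \<times> nat) \<Rightarrow> real \<Rightarrow> real^'n^'n" where
  "network_matrix N cell t =
     (\<chi> p q. network_block N t (fst (cell p)) (fst (cell q)) (snd (cell p)) (snd (cell q)))"

definition output_matrix ::
    "'r::finite traffic_network \<Rightarrow> ('n::finite \<Rightarrow> 'r \<times> nat) \<Rightarrow> real^'n^'r" where
  "output_matrix N cell =
     (\<chi> i p. if fst (cell p) = i then canon (num_cells N i) (snd (cell p)) else 0)"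

definition changes_value_at :: "(real \<Rightarrow> 'a) \<Rightarrow> real \<Rightarrow> bool" where
  "changes_value_at f t \<longleftrightarrow> \<not> (\<forall>\<^sub>F u in nhds t. f u = f t)"

text \<open>The endpoints of the period are included whether or not a green split changes value there.\<close>

definition switching_instants :: "'r traffic_network \<Rightarrow> real set" where
  "switching_instants N =
     {0, cycle_time N} \<union>
     {t \<in> {0<..<cycle_time N}. \<exists>i k. changes_value_at (green_split N i k) t}"

definition network_modes ::
    "'r::finite traffic_network \<Rightarrow> ('n::finite \<Rightarrow> 'r \<times> nat) \<Rightarrow> nat \<Rightarrow> (nat \<Rightarrow> real) \<Rightarrow>
      (nat \<Rightarrow> real^'n^'n) \<Rightarrow> bool" where
  "network_modes N cell m \<tau> A \<longleftrightarrow>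
     strict_mono_on {0..m} \<tau> \<and> \<tau> ` {0..m} = switching_instants N \<and>
     (\<forall>i\<in>{1..m}. \<forall>t\<in>{\<tau> (i - 1)<..<\<tau> i}. network_matrix N cell t = A i)"

section \<open>Extended-real integrals and matrices\<close>

text \<open>
  For nonnegative integrands this is the Lebesgue integral over \<open>[0, \<infinity>)\<close> with values in
  \<open>[0, \<infinity>]\<close>. If the positive and the negative part both have infinite integral, the value is
  an arbitrary convention.
\<close>

definition ext_integral :: "(real \<Rightarrow> real) \<Rightarrow> ereal" where
  "ext_integral f =
     enn2ereal (\<integral>\<^sup>+ t\<in>{0..}. ennreal (f t) \<partial>lborel)
       - enn2ereal (\<integral>\<^sup>+ t\<in>{0..}. ennreal (- f t) \<partial>lborel)"

text \<open>
  The library's matrix product and trace need a semiring, which \<^typ>\<open>ereal\<close> is not.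
  Note that \<open>0 * \<infinity> = 0\<close> in \<^typ>\<open>ereal\<close>.
\<close>

definition ereal_matrix_mult :: "ereal^'n^'m \<Rightarrow> ereal^'p^'n \<Rightarrow> ereal^'p^'m" where
  "ereal_matrix_mult X Y = (\<chi> i j. \<Sum>k\<in>UNIV. X $ i $ k * Y $ k $ j)"

definition ereal_trace :: "ereal^'n^'n \<Rightarrow> ereal" where
  "ereal_trace X = (\<Sum>i\<in>UNIV. X $ i $ i)"

primrec matrix_power :: "real^'n^'n \<Rightarrow> nat \<Rightarrow> real^'n^'n" where
  "matrix_power A 0 = mat 1"
| "matrix_power A (Suc k) = A ** matrix_power A k"

definition matrix_exp :: "real^'n^'n \<Rightarrow> real^'n^'n" where
  "matrix_exp A = (\<Sum>k. (1 / fact k) *\<^sub>R matrix_power A k)"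

definition gramian :: "real^'n^'n \<Rightarrow> real^'n \<Rightarrow> ereal^'n^'n" where
  "gramian A x0 =
     (\<chi> p q. ext_integral (\<lambda>t.
        (matrix_exp (t *\<^sub>R A) ** ((columnvector x0 :: real^1^'n) ** (rowvector x0 :: real^'n^1))
           ** matrix_exp (t *\<^sub>R transpose A)) $ p $ q))"

definition gramian_cost :: "real^'n^'r \<Rightarrow> real^'n^'n \<Rightarrow> real^'n \<Rightarrow> ereal" where
  "gramian_cost C A x0 =
     ereal_trace (ereal_matrix_mult
       (ereal_matrix_mult (map_matrix ereal C) (gramian A x0))
       (map_matrix ereal (transpose C)))"

section \<open>The two minimization problems\<close>

text \<open>A tuple of durations is a function on \<open>{1..m}\<close> that is \<open>undefined\<close> outside this set.\<close>

definition duration_constraints ::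
    "real \<Rightarrow> nat \<Rightarrow> (nat \<Rightarrow> real^'n^'n) \<Rightarrow> (nat \<Rightarrow> real) \<Rightarrow> real^'n^'n \<Rightarrow> bool" where
  "duration_constraints T m A d Aav \<longleftrightarrow>
     d \<in> extensional {1..m} \<and>
     Aav = (1 / T) *\<^sub>R (\<Sum>i=1..m. d i *\<^sub>R A i) \<and>
     T = (\<Sum>i=1..m. d i) \<and>
     (\<forall>i\<in>{1..m}. d i \<ge> 0)"

definition trajectory_constraints ::
    "real^'n^'n \<Rightarrow> real^'n^'r \<Rightarrow> real^'n \<Rightarrow> (real \<Rightarrow> real^'n) \<Rightarrow> (real \<Rightarrow> real^'r) \<Rightarrow> bool" where
  "trajectory_constraints Aav C x0 x y \<longleftrightarrow>
     (\<forall>t\<ge>0. (x has_vector_derivative (Aav *v x t)) (at t within {0..})) \<and>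
     (\<forall>t\<ge>0. y t = C *v x t) \<and>
     x 0 = x0"

text \<open>
  A minimization problem is represented by the set of all pairs of a feasible tuple of durations
  and a cost attained there.
\<close>

definition gramian_problem ::
    "real \<Rightarrow> nat \<Rightarrow> (nat \<Rightarrow> real^'n^'n) \<Rightarrow> real^'n^'r \<Rightarrow> real^'n \<Rightarrow> ((nat \<Rightarrow> real) \<times> ereal) set" where
  "gramian_problem T m A C x0 =
     {(d, gramian_cost C Aav x0) | d Aav. duration_constraints T m A d Aav}"

definition trajectory_problem ::
    "real \<Rightarrow> nat \<Rightarrow> (nat \<Rightarrow> real^'n^'n) \<Rightarrow> real^'n^'r \<Rightarrow> real^'n \<Rightarrow> ((nat \<Rightarrow> real) \<times> ereal) set" where
  "trajectory_problem T m A C x0 =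
     {(d, ext_integral (\<lambda>t. (norm (y t))\<^sup>2)) | d Aav x y.
        duration_constraints T m A d Aav \<and> trajectory_constraints Aav C x0 x y}"

text \<open>
  Equal feasible sets, and every cost of \<open>P\<close> at a feasible point equals every cost of \<open>Q\<close> there;
  in particular, the cost of each problem is then uniquely determined by the durations.
\<close>

definition equivalent_problems :: "('d \<times> ereal) set \<Rightarrow> ('d \<times> ereal) set \<Rightarrow> bool" where
  "equivalent_problems P Q \<longleftrightarrow>
     fst ` P = fst ` Q \<and>
     (\<forall>d v w. (d, v) \<in> P \<longrightarrow> (d, w) \<in> Q \<longrightarrow> v = w \<and> v \<in> {0..\<infinity>})"

end

theory Submission
  imports Defs
begin

text \<open>
  The unique solution of the linear system is \<open>x t = matrix_exp (t *\<^sub>R A) *v x0\<close>, and the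
  diagonal entries of the integrand of the Gramian are the squares of the components of this
  vector. Since every row of the output matrix is a unit vector, the trace picks out the diagonal
  entries belonging to the last cells, and the claim is additivity of the Lebesgue integral on
  nonnegative functions.
\<close>

section \<open>The matrix exponential\<close>

text \<open>Bilinear maps in finite dimension are bounded; the bound stands in for
  submultiplicativity of the norm when the exponential series is estimated.\<close>

lemma bounded_bilinear_matrix_matrix_mult:
  "bounded_bilinear ((**) :: real^'n^'m \<Rightarrow> real^'p^'n \<Rightarrow> real^'p^'m)"
  unfolding bilinear_conv_bounded_bilinear [symmetric] bilinear_def
  by (auto intro!: linearI simp: matrix_add_ldistrib matrix_matrix_mult_def vec_eq_iff
      sum.distrib sum_distrib_left algebra_simps)

lemma summable_matrix_exp:
  fixes A :: "real^'n^'n"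
  shows "summable (\<lambda>k. (1 / fact k) *\<^sub>R matrix_power A k)"
proof -
  obtain K where K: "K > 0" "\<And>(B :: real^'n^'n) (C :: real^'n^'n). norm (B ** C) \<le> norm B * norm C * K"
    using bounded_bilinear.pos_bounded [OF bounded_bilinear_matrix_matrix_mult] by metis
  \<comment> \<open>The matrix norm is Euclidean, so \<open>mat 1\<close> need not have norm 1 and
    its norm stays as a factor. The majorant is the exponential series at
    \<open>K * norm A\<close>.\<close>
  have bound: "norm (matrix_power A k) \<le> norm (mat 1 :: real^'n^'n) * (K * norm A) ^ k" for k
  proof (induction k)
    case (Suc k)
    have "norm (matrix_power A (Suc k)) \<le> (K * norm A) * norm (matrix_power A k)"
      using K(2) [of A "matrix_power A k"] by (simp add: mult_ac)
    also have "\<dots> \<le> (K * norm A) * (norm (mat 1 :: real^'n^'n) * (K * norm A) ^ k)"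
      using K(1) by (intro mult_left_mono Suc) auto
    finally show ?case
      by (simp add: mult_ac)
  qed simp
  have "summable (\<lambda>k. norm (mat 1 :: real^'n^'n) * (inverse (fact k) * (K * norm A) ^ k))"
    by (intro summable_mult summable_exp)
  then show ?thesis
    by (rule summable_comparison_test')
      (use bound in \<open>simp add: field_simps\<close>)
qed

text \<open>Bounded linear maps pass through a convergent series, so facts about powers carry over
  to the exponential.\<close>

lemma bounded_linear_matrix_exp_sums:
  assumes "bounded_linear (f :: real^'n^'n \<Rightarrow> 'b::real_normed_vector)"
  shows "(\<lambda>k. (1 / fact k) *\<^sub>R f (matrix_power A k)) sums f (matrix_exp A)"
  using bounded_linear.sums [OF assms summable_sums [OF summable_matrix_exp [of A]]]
  by (simp add: matrix_exp_def bounded_linear.linear [OF assms] linear_cmul)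

text \<open>Transposition reverses products, while powers are built by multiplying on the left; this
  restores the order.\<close>

lemma matrix_power_commute: "A ** matrix_power A k = matrix_power A k ** A"
  by (induction k) (simp_all, metis matrix_mul_assoc)

lemma matrix_power_scaleR: "matrix_power (c *\<^sub>R A) k = c ^ k *\<^sub>R matrix_power A k"
  by (induction k) (simp_all add: bounded_bilinear.scaleR_left [OF bounded_bilinear_matrix_matrix_mult]
      bounded_bilinear.scaleR_right [OF bounded_bilinear_matrix_matrix_mult])

lemma matrix_power_transpose: "matrix_power (transpose A) k = transpose (matrix_power A k)"
  by (induction k) (simp_all add: matrix_transpose_mul matrix_power_commute)

lemma matrix_exp_transpose: "matrix_exp (transpose A) = transpose (matrix_exp (A :: real^'n^'n))"
proof -
  have "bounded_linear (transpose :: real^'n^'n \<Rightarrow> real^'n^'n)"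
    unfolding linear_conv_bounded_linear [symmetric]
    by (auto intro!: linearI simp: transpose_def vec_eq_iff)
  from bounded_linear_matrix_exp_sums [OF this, of A]
    bounded_linear_matrix_exp_sums [OF bounded_linear_ident, of "transpose A"]
  show ?thesis
    by (simp add: matrix_power_transpose sums_iff)
qed

lemma matrix_exp_zero: "matrix_exp (0 :: real^'n^'n) = mat 1"
proof -
  have *: "(1 / fact k) *\<^sub>R matrix_power (0 :: real^'n^'n) k = (if k = 0 then mat 1 else 0)" for k
    by (cases k) (simp_all add: matrix_matrix_mult_def vec_eq_iff)
  show ?thesis
    unfolding matrix_exp_def * using suminf_finite [of "{0}" "\<lambda>k. if k = 0 then mat 1 else 0"] by simp
qed

lemma bounded_linear_matrix_vector_mult_nth:
  "bounded_linear (\<lambda>M :: real^'n^'m. (M *v x) $ p)"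
  unfolding linear_conv_bounded_linear [symmetric]
  by (auto intro!: linearI simp: matrix_vector_mult_def sum.distrib sum_distrib_left algebra_simps)

text \<open>Each coordinate becomes a scalar power series in \<open>t\<close>, ready for termwise
  differentiation.\<close>

lemma matrix_exp_vector_mult_power_series:
  fixes A :: "real^'n^'n"
  shows "(\<lambda>k. (matrix_power A k *v x) $ p / fact k * t ^ k) sums (matrix_exp (t *\<^sub>R A) *v x) $ p"
  using bounded_linear_matrix_exp_sums [OF bounded_linear_matrix_vector_mult_nth, of "t *\<^sub>R A" x p]
  by (simp add: matrix_power_scaleR mult_ac scaleR_matrix_vector_assoc [symmetric])

section \<open>Linear differential equations with constant coefficients\<close>

lemma has_vector_derivative_vec_componentwise:
  fixes f :: "real \<Rightarrow> real^'n"
  assumes "\<And>p. ((\<lambda>t. f t $ p) has_real_derivative f' $ p) (at t within S)"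
  shows "(f has_vector_derivative f') (at t within S)"
  unfolding has_vector_derivative_def
  by (subst has_derivative_componentwise_within)
    (use assms in \<open>auto simp: Basis_vec_def inner_axis has_field_derivative_def mult_commute_abs\<close>)

lemma has_vector_derivative_matrix_exp:
  fixes A :: "real^'n^'n"
  shows "((\<lambda>t. matrix_exp (t *\<^sub>R A) *v x) has_vector_derivative A *v (matrix_exp (t *\<^sub>R A) *v x))
           (at t within S)"
proof -
  have "((\<lambda>t. (matrix_exp (t *\<^sub>R A) *v x) $ p) has_real_derivative
          (A *v (matrix_exp (t *\<^sub>R A) *v x)) $ p) (at t)" for p
  proof -
    define c where "c = (\<lambda>k. (matrix_power A k *v x) $ p / fact k)"
    have sums: "(\<lambda>k. c k * s ^ k) sums (matrix_exp (s *\<^sub>R A) *v x) $ p" for s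
      unfolding c_def by (rule matrix_exp_vector_mult_power_series)
    have "bounded_linear (\<lambda>M. (A *v (M *v x)) $ p)"
      unfolding matrix_vector_mul_assoc
      by (rule bounded_linear_compose [OF bounded_linear_matrix_vector_mult_nth
            bounded_bilinear.bounded_linear_right [OF bounded_bilinear_matrix_matrix_mult]])
    \<comment> \<open>The factor \<open>k + 1\<close> of the differentiated series cancels against
      \<open>fact (k + 1)\<close>, and the additional power of \<open>A\<close> splits off on the
      left.\<close>
    moreover have "diffs c k = (A *v (matrix_power A k *v x)) $ p / fact k" for k
      by (simp add: diffs_def c_def matrix_vector_mul_assoc del: of_nat_Suc)
    ultimately have "(\<lambda>k. diffs c k * t ^ k) sums (A *v (matrix_exp (t *\<^sub>R A) *v x)) $ p"
      using bounded_linear_matrix_exp_sums [of "\<lambda>M. (A *v (M *v x)) $ p" "t *\<^sub>R A"]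
      by (simp add: matrix_power_scaleR scaleR_matrix_vector_assoc [symmetric]
          matrix_vector_mult_scaleR mult_ac)
    then show ?thesis
      using termdiffs_strong_converges_everywhere [of c t] sums
      by (simp add: sums_iff)
  qed
  then show ?thesis
    by (rule has_vector_derivative_vec_componentwise [OF has_field_derivative_at_within])
qed

lemma linear_ode_unique:
  fixes A :: "real^'n^'n"
  assumes x: "\<And>t. t \<ge> 0 \<Longrightarrow> (x has_vector_derivative A *v x t) (at t within {0..})"
    and y: "\<And>t. t \<ge> 0 \<Longrightarrow> (y has_vector_derivative A *v y t) (at t within {0..})"
    and "x 0 = y 0" "t \<ge> 0"
  shows "x t = y t"
proof -
  define z where "z = (\<lambda>t. x t - y t)"
  define L where "L = 2 * onorm ((*v) A)"
  \<comment> \<open>Gronwall: this weighted square of the distance is nonincreasing.\<close>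
  define g where "g = (\<lambda>t. exp (- L * t) * (z t \<bullet> z t))"
  define g' where "g' = (\<lambda>t. exp (- L * t) * (2 * (z t \<bullet> (A *v z t)) - L * (z t \<bullet> z t)))"
  have z: "(z has_vector_derivative A *v z s) (at s within {0..t})" if "s \<in> {0..t}" for s
    using that has_vector_derivative_diff [OF x y, of s]
    by (auto simp: z_def matrix_vector_mult_diff_distrib
        intro: has_vector_derivative_within_subset)
  have "(g has_derivative (\<lambda>h. h * g' s)) (at s within {0..t})" if "s \<in> {0..t}" for s
    unfolding g_def
    by (rule derivative_eq_intros z [OF that, unfolded has_vector_derivative_def] refl)+
      (auto simp: g'_def fun_eq_iff inner_commute algebra_simps)
  \<comment> \<open>At 0 only a one-sided derivative is available, hence the derivatives within
    \<open>{0..t}\<close>.\<close>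
  from mvt_very_simple [OF \<open>t \<ge> 0\<close>, of g, OF this] obtain s where s: "g t - g 0 = t * g' s"
    by auto
  \<comment> \<open>Differentiating the square gives twice this inner product, which the term with
    \<open>L\<close> therefore dominates.\<close>
  have "z s \<bullet> (A *v z s) \<le> norm (z s) * norm (A *v z s)"
    by (rule norm_cauchy_schwarz)
  also have "\<dots> \<le> norm (z s) * (onorm ((*v) A) * norm (z s))"
    by (intro mult_left_mono onorm) auto
  finally have "g' s \<le> 0"
    by (auto simp: g'_def L_def mult_le_0_iff dot_square_norm power2_eq_square mult_ac)
  then have "t * g' s \<le> 0"
    using \<open>t \<ge> 0\<close> by (rule mult_nonneg_nonpos [rotated])
  with s have "g t \<le> g 0"
    by linarith
  then have "z t \<bullet> z t \<le> 0"
    using \<open>x 0 = y 0\<close> by (simp add: g_def z_def mult_le_0_iff)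
  then have "z t \<bullet> z t = 0"
    using inner_ge_zero [of "z t"] by linarith
  then show ?thesis
    by (simp add: z_def)
qed

text \<open>Existence and uniqueness together. Values at negative times remain free, but the cost
  does not see them.\<close>

lemma trajectory_constraints_iff:
  "trajectory_constraints A C x0 x y \<longleftrightarrow>
     (\<forall>t\<ge>0. x t = matrix_exp (t *\<^sub>R A) *v x0 \<and> y t = C *v (matrix_exp (t *\<^sub>R A) *v x0))"
    (is "?L \<longleftrightarrow> ?R")
proof
  assume L: ?L
  have "x t = matrix_exp (t *\<^sub>R A) *v x0" if "t \<ge> 0" for t
    by (rule linear_ode_unique [OF _ has_vector_derivative_matrix_exp _ that])
      (use L in \<open>auto simp: trajectory_constraints_def matrix_exp_zero\<close>)
  with L show ?R
    by (auto simp: trajectory_constraints_def)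
next
  assume R: ?R
  have "(x has_vector_derivative A *v x t) (at t within {0..})" if "t \<ge> 0" for t
    by (rule has_vector_derivative_transform
        [OF _ _ has_vector_derivative_matrix_exp [of A x0 t, folded R [rule_format, OF that, THEN conjunct1]]])
      (use R that in auto)
  with R show ?L
    by (auto simp: trajectory_constraints_def matrix_exp_zero)
qed

section \<open>The two costs\<close>

text \<open>The negative part vanishes on the domain of integration, so the subtracted integral is
  0.\<close>

lemma ext_integral_nonneg:
  assumes "\<And>t. t \<ge> 0 \<Longrightarrow> f t \<ge> 0"
  shows "ext_integral f = enn2ereal (\<integral>\<^sup>+ t\<in>{0..}. ennreal (f t) \<partial>lborel)"
proof -
  have "(\<integral>\<^sup>+ t\<in>{0..}. ennreal (- f t) \<partial>lborel) = (\<integral>\<^sup>+ t. 0 \<partial>(lborel :: real measure))"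
  proof (rule nn_integral_cong)
    show "ennreal (- f t) * indicator {0..} t = 0" for t
      using assms [of t] by (cases "t \<ge> 0") (simp_all add: ennreal_neg)
  qed
  then show ?thesis
    by (simp add: ext_integral_def zero_ennreal.rep_eq)
qed

text \<open>The integrand is the rank-one matrix of products of coordinates of
  \<open>matrix_exp (t *\<^sub>R A) *v x0\<close>, so its diagonal consists of squares.\<close>

lemma gramian_diagonal:
  fixes A :: "real^'n^'n"
  shows "gramian A x0 $ p $ p = ext_integral (\<lambda>t. ((matrix_exp (t *\<^sub>R A) *v x0) $ p)\<^sup>2)"
proof -
  have "(M ** ((columnvector x0 :: real^1^'n) ** (rowvector x0 :: real^'n^1)) ** transpose M) $ p $ p
      = ((M *v x0) $ p)\<^sup>2" for M :: "real^'n^'n"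
  proof -
    have "M ** ((columnvector x0 :: real^1^'n) ** (rowvector x0 :: real^'n^1)) ** transpose M
        = (columnvector (M *v x0) :: real^1^'n) ** (rowvector (M *v x0) :: real^'n^1)"
      by (simp add: dot_rowvector_columnvector matrix_mul_assoc matrix_transpose_mul
          flip: transpose_columnvector)
    then show ?thesis
      by (simp add: columnvector_def rowvector_def matrix_matrix_mult_def power2_eq_square)
  qed
  moreover have "t *\<^sub>R transpose A = transpose (t *\<^sub>R A)" for t
    by (simp add: transpose_def vec_eq_iff)
  ultimately show ?thesis
    by (simp add: gramian_def matrix_exp_transpose)
qed

text \<open>Since \<open>0 * \<infinity> = 0\<close> in \<open>ereal\<close>, zero entries of
  \<open>C\<close> remove even infinite entries of the Gramian, and no off-diagonal entry survives
  in the trace.\<close>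

lemma gramian_cost_selecting:
  fixes C :: "real^'n^'r" and q :: "'r \<Rightarrow> 'n"
  assumes "\<And>i p. C $ i $ p = (if p = q i then 1 else 0)"
  shows "gramian_cost C A x0 = (\<Sum>i\<in>UNIV. gramian A x0 $ q i $ q i)"
proof -
  have "ereal (if P then 1 else 0) = (if P then 1 else 0)" for P
    by simp
  then show ?thesis
    by (simp add: gramian_cost_def ereal_trace_def ereal_matrix_mult_def map_matrix_def
        transpose_def assms if_distrib [of "\<lambda>a. a * _"] if_distrib [of "\<lambda>a. _ * a"] cong: if_cong)
qed

lemma gramian_cost_eq_output_cost:
  fixes C :: "real^'n^'r" and q :: "'r \<Rightarrow> 'n"
  assumes C: "\<And>i p. C $ i $ p = (if p = q i then 1 else 0)"
    and y: "\<And>t. t \<ge> 0 \<Longrightarrow> y t = C *v (matrix_exp (t *\<^sub>R A) *v x0)"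
  shows "gramian_cost C A x0 = ext_integral (\<lambda>t. (norm (y t))\<^sup>2)"
proof -
  define f where "f = (\<lambda>t i. ((matrix_exp (t *\<^sub>R A) *v x0) $ q i)\<^sup>2)"
  have f: "f t i \<ge> 0" for t i
    by (simp add: f_def)
  \<comment> \<open>Continuity, obtained from differentiability, gives the measurability that
    additivity of the integral requires.\<close>
  have "continuous_on UNIV (\<lambda>t. matrix_exp (t *\<^sub>R A) *v x0)"
    using has_vector_derivative_matrix_exp
    by (rule continuous_on_vector_derivative)
  then have "continuous_on UNIV (\<lambda>t. f t i)" for i
    unfolding f_def by (intro continuous_intros)
  then have meas [measurable]: "(\<lambda>t. f t i) \<in> borel_measurable borel" for i
    by (rule borel_measurable_continuous_onI)
  have norm: "(norm (y t))\<^sup>2 = (\<Sum>i\<in>UNIV. f t i)" if "t \<ge> 0" for t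
  proof -
    have "y t $ i = (matrix_exp (t *\<^sub>R A) *v x0) $ q i" for i
      by (simp add: y [OF that] matrix_vector_mult_def [of C] C if_distrib [of "\<lambda>a. a * _"]
          cong: if_cong)
    then show ?thesis
      by (simp add: norm_vec_def L2_set_def f_def sum_nonneg)
  qed
  have "gramian_cost C A x0 = (\<Sum>i\<in>UNIV. ext_integral (\<lambda>t. f t i))"
    by (simp add: gramian_cost_selecting [OF C] gramian_diagonal f_def)
  also have "\<dots> = (\<Sum>i\<in>UNIV. enn2ereal (\<integral>\<^sup>+ t\<in>{0..}. ennreal (f t i) \<partial>lborel))"
    by (simp add: ext_integral_nonneg f)
  also have "\<dots> = enn2ereal (\<Sum>i\<in>UNIV. \<integral>\<^sup>+ t\<in>{0..}. ennreal (f t i) \<partial>lborel)"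
    by (rule sum_enn2ereal) simp
  also have "(\<Sum>i\<in>UNIV. \<integral>\<^sup>+ t\<in>{0..}. ennreal (f t i) \<partial>lborel)
      = (\<integral>\<^sup>+ t. (\<Sum>i\<in>UNIV. ennreal (f t i) * indicator {0..} t) \<partial>lborel)"
    by (rule nn_integral_sum [symmetric]) measurable
  \<comment> \<open>The indicator kills negative times, where nothing is known about
    \<open>y\<close>.\<close>
  also have "\<dots> = (\<integral>\<^sup>+ t\<in>{0..}. ennreal ((norm (y t))\<^sup>2) \<partial>lborel)"
    by (intro nn_integral_cong) (auto simp: indicator_def norm sum_ennreal f)
  also have "enn2ereal \<dots> = ext_integral (\<lambda>t. (norm (y t))\<^sup>2)"
    by (simp add: ext_integral_nonneg)
  finally show ?thesis .
qed

lemma output_matrix_selecting: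
  fixes N :: "'r::finite traffic_network" and cell :: "'n::finite \<Rightarrow> 'r \<times> nat"
  assumes "valid_network N" "cell_enumeration N cell"
  obtains q where "\<And>i p. output_matrix N cell $ i $ p = (if p = q i then 1 else 0)"
proof
  fix i p
  have bij: "bij_betw cell UNIV (SIGMA i:UNIV. {1..num_cells N i})"
    using assms by (simp add: cell_enumeration_def)
  \<comment> \<open>Positive length and step make the ceiling at least 1, so road \<open>i\<close>
    has a last cell; its coordinate is the witness \<open>q i\<close>.\<close>
  have "num_cells N i \<ge> 1"
    using assms by (simp add: valid_network_def num_cells_def Suc_le_eq)
  then have "cell (inv cell (i, num_cells N i)) = (i, num_cells N i)"
    by (intro f_inv_into_f) (use bij in \<open>auto simp: bij_betw_def\<close>)
  moreover have "inj cell"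
    using bij by (simp add: bij_betw_def)
  ultimately have "p = inv cell (i, num_cells N i) \<longleftrightarrow> cell p = (i, num_cells N i)"
    by (metis injD)
  then show "output_matrix N cell $ i $ p = (if p = inv cell (i, num_cells N i) then 1 else 0)"
    by (auto simp: output_matrix_def canon_def prod_eq_iff)
qed

theorem lemma2:
  fixes N :: "'r::finite traffic_network"
    and cell :: "'n::finite \<Rightarrow> 'r \<times> nat"
    and m :: nat
    and \<tau> :: "nat \<Rightarrow> real"
    and A :: "nat \<Rightarrow> real^'n^'n"
    and x0 :: "real^'n"
  assumes "valid_network N"
    and "cell_enumeration N cell"
    and "network_modes N cell m \<tau> A"
  shows "equivalent_problems
           (gramian_problem (cycle_time N) m A (output_matrix N cell) x0)
           (trajectory_problem (cycle_time N) m A (output_matrix N cell) x0)"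
proof -
  let ?C = "output_matrix N cell"
  let ?T = "cycle_time N"
  obtain q where q: "\<And>i p. ?C $ i $ p = (if p = q i then 1 else 0)"
    using output_matrix_selecting assms(1,2) by blast
  have cost: "gramian_cost ?C B x0 = ext_integral (\<lambda>t. (norm (y t))\<^sup>2)"
    if "trajectory_constraints B ?C x0 x y" for B x y
    using that by (intro gramian_cost_eq_output_cost [OF q]) (simp add: trajectory_constraints_iff)
  \<comment> \<open>Durations are feasible for the second problem only if a trajectory exists, so
    equality of the feasible sets rests on this.\<close>
  have ex: "\<exists>x y. trajectory_constraints B ?C x0 x y" for B
    unfolding trajectory_constraints_iff by (intro exI allI impI conjI) (rule refl)+
  have eq: "gramian_problem ?T m A ?C x0 = trajectory_problem ?T m A ?C x0"
    unfolding gramian_problem_def trajectory_problem_def using cost ex by (auto, metis+)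
  \<comment> \<open>With the two sets equal, each property is read off the more convenient form:
    uniqueness from the Gramian form, where \<open>d\<close> determines the averaged matrix, and
    nonnegativity from the integral of a square.\<close>
  have "v = w \<and> v \<in> {0..\<infinity>}"
    if "(d, v) \<in> gramian_problem ?T m A ?C x0" "(d, w) \<in> gramian_problem ?T m A ?C x0" for d v w
  proof -
    have "v = w"
      using that by (auto simp: gramian_problem_def duration_constraints_def)
    moreover have "v \<ge> 0"
      using that(1) unfolding eq by (auto simp: trajectory_problem_def ext_integral_nonneg)
    ultimately show ?thesis
      by simp
  qed
  then show ?thesis
    unfolding equivalent_problems_def eq [symmetric] by blast
qed

end
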